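(* Let $\Delta\ge 6$ and let $n=k\Delta+1+j$, where $k\geq\Delta-1$ and $1\leq j\leq\Delta-1$ are integers. Then the family $\mathcal{T}'_{n,\Delta}$ is not empty and all trees in $\mathcal{T}'_{n,\Delta}$ have the same value of $\sigma$-irregularity.
   Context: For a graph $G$, $\sigma(G)=\sum_{uv\in E(G)}(d(u)-d(v))^2$, where $d(u)$ is the degree of $u$. For a tree $T$, $n_i$ is the number of vertices of degree $i$, and $m_{ij}=m_{ji}$ is the number of edges whose end-vertices have degrees $i$ and $j$. An internal leaf of a tree is a vertex of degree at least $2$ having precisely one neighbor of degree greater than $1$. The family $\mathcal{T}'_{n,\Delta}$ consists of all trees $T$ on $n$ vertices with maximum degree $\Delta$ such that: (1) all internal leaves of $T$ have degree $\Delta$; (2) $m_{22}\le 2$ and $m_{\Delta\Delta}=0$; (3) $\sum_{i=3}^{\Delta-1}n_i\le 1$; (4) $m_{22}=0$ if and only if $\sum_{i=3}^{\Delta-1}n_i=n_a=1$ for some $a\in\{3,\ldots,\Delta-1\}$; (5) if $m_{22}=0$, then $m_{a2}=a$, where $a$ is the degree from (4). *)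

theory Defs
  imports Main
begin

record 'a sgraph =
  verts :: "'a set"
  edges :: "'a set set"

definition simple_graph :: "'a sgraph \<Rightarrow> bool" where
  "simple_graph G \<longleftrightarrow> finite (verts G) \<and> verts G \<noteq> {}
     \<and> (\<forall>e\<in>edges G. e \<subseteq> verts G \<and> card e = 2)"

definition adj :: "'a sgraph \<Rightarrow> 'a \<Rightarrow> 'a \<Rightarrow> bool" where
  "adj G u v \<longleftrightarrow> {u, v} \<in> edges G"

definition degree :: "'a sgraph \<Rightarrow> 'a \<Rightarrow> nat" where
  "degree G v = card {e \<in> edges G. v \<in> e}"

definition max_degree :: "'a sgraph \<Rightarrow> nat" where
  "max_degree G = Max (degree G ` verts G)"

definition connected_graph :: "'a sgraph \<Rightarrow> bool" where
  "connected_graph G \<longleftrightarrow> (\<forall>u\<in>verts G. \<forall>v\<in>verts G. (adj G)\<^sup>*\<^sup>* u v)"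

definition is_cycle :: "'a sgraph \<Rightarrow> 'a list \<Rightarrow> bool" where
  "is_cycle G p \<longleftrightarrow> length p \<ge> 3 \<and> distinct p
     \<and> (\<forall>i<length p. adj G (p ! i) (p ! ((i + 1) mod length p)))"

definition is_tree :: "'a sgraph \<Rightarrow> bool" where
  "is_tree G \<longleftrightarrow> simple_graph G \<and> connected_graph G \<and> (\<nexists>p. is_cycle G p)"

text \<open>The contribution of an edge is well defined since it is symmetric in the two
  end-vertices; degrees are taken in the integers to avoid truncated subtraction.\<close>

definition edge_contrib :: "'a sgraph \<Rightarrow> 'a set \<Rightarrow> int" where
  "edge_contrib G e =
     (THE x. \<exists>u v. e = {u, v} \<and> x = (int (degree G u) - int (degree G v))\<^sup>2)"

lemma edge_contrib_doubleton [simp]: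
  "edge_contrib G {u, v} = (int (degree G u) - int (degree G v))\<^sup>2"
  unfolding edge_contrib_def
  by (rule the_equality) (auto simp: doubleton_eq_iff power2_commute)

definition sigma_irr :: "'a sgraph \<Rightarrow> int" where
  "sigma_irr G = (\<Sum>e\<in>edges G. edge_contrib G e)"

definition num_deg :: "'a sgraph \<Rightarrow> nat \<Rightarrow> nat" where
  "num_deg G i = card {v \<in> verts G. degree G v = i}"

definition num_edges_deg :: "'a sgraph \<Rightarrow> nat \<Rightarrow> nat \<Rightarrow> nat" where
  "num_edges_deg G i j =
     card {e \<in> edges G. \<exists>u v. e = {u, v} \<and> degree G u = i \<and> degree G v = j}"

definition internal_leaf :: "'a sgraph \<Rightarrow> 'a \<Rightarrow> bool" where
  "internal_leaf G v \<longleftrightarrow> v \<in> verts G \<and> degree G v \<ge> 2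
     \<and> card {u \<in> verts G. adj G v u \<and> degree G u > 1} = 1"

definition unique_mid_degree :: "'a sgraph \<Rightarrow> nat \<Rightarrow> nat \<Rightarrow> bool" where
  "unique_mid_degree G \<Delta> a \<longleftrightarrow> a \<in> {3..\<Delta> - 1}
     \<and> (\<Sum>i = 3..\<Delta> - 1. num_deg G i) = num_deg G a \<and> num_deg G a = 1"

definition tree_family :: "nat \<Rightarrow> nat \<Rightarrow> 'a sgraph set" where
  "tree_family n \<Delta> = {T. is_tree T \<and> card (verts T) = n \<and> max_degree T = \<Delta>
     \<and> (\<forall>v. internal_leaf T v \<longrightarrow> degree T v = \<Delta>)
     \<and> num_edges_deg T 2 2 \<le> 2 \<and> num_edges_deg T \<Delta> \<Delta> = 0
     \<and> (\<Sum>i = 3..\<Delta> - 1. num_deg T i) \<le> 1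
     \<and> (num_edges_deg T 2 2 = 0 \<longleftrightarrow> (\<exists>a. unique_mid_degree T \<Delta> a))
     \<and> (num_edges_deg T 2 2 = 0 \<longrightarrow>
          (\<forall>a. unique_mid_degree T \<Delta> a \<longrightarrow> num_edges_deg T a 2 = a))}"

end

theory Submission
  imports Defs
begin

text \<open>For a tree in the family, each edge joins a leaf or a vertex of degree 2 to a vertex of degree
  \<open>\<Delta>\<close>, or joins two vertices of degree 2, or is incident with the unique vertex of intermediate
  degree \<open>a\<close>: a leaf cannot hang on a vertex of degree 2, as that would be an internal leaf. Counting
  vertices, edges and incidences for each degree gives \<open>n = \<Delta> * n_\<Delta> + 1 + m_22\<close> if \<open>m_22 > 0\<close> and
  \<open>n = \<Delta> * n_\<Delta> + 1 + a\<close> otherwise, so by uniqueness of division with remainder \<open>n_\<Delta> = k\<close>, and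
  \<open>j\<close> is \<open>m_22\<close> or \<open>a\<close>. This determines the number of edges of each type and hence \<open>\<sigma>\<close>.

  A member is built from \<open>k\<close> vertices of degree \<open>\<Delta>\<close>: for \<open>j \<ge> 2\<close> a vertex of degree \<open>j\<close> is the centre
  of a spider in which every second vertex of a leg is to have degree \<open>\<Delta>\<close>, for \<open>j = 1\<close> one takes a
  path whose interior starts with two vertices of degree 2; pendent vertices are added as
  needed.\<close>

subsection \<open>Degrees and edges of trees\<close>

lemma adj_sym: "adj G u v \<longleftrightarrow> adj G v u"
  by (simp add: adj_def insert_commute)

lemma adj_verts:
  assumes "simple_graph G" "adj G u v"
  shows "u \<in> verts G" "v \<in> verts G" "u \<noteq> v"
proof -
  have e: "{u, v} \<subseteq> verts G" "card {u, v} = 2"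
    using assms unfolding simple_graph_def adj_def by blast+
  then show "u \<in> verts G" "v \<in> verts G" by auto
  show "u \<noteq> v" using e(2) by auto
qed

lemma finite_edges:
  assumes "simple_graph G"
  shows "finite (edges G)"
proof (rule finite_subset)
  show "edges G \<subseteq> Pow (verts G)" "finite (Pow (verts G))"
    using assms by (auto simp: simple_graph_def)
qed

lemma edgeE:
  assumes "simple_graph G" "e \<in> edges G"
  obtains u v where "e = {u, v}" "u \<noteq> v" "u \<in> verts G" "v \<in> verts G" "adj G u v"
proof -
  from assms have "card e = 2" "e \<subseteq> verts G" by (auto simp: simple_graph_def)
  then obtain u v where "e = {u, v}" "u \<noteq> v" by (auto simp: card_2_iff)
  with that \<open>e \<subseteq> verts G\<close> assms(2) show ?thesis by (auto simp: adj_def)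
qed

lemma degree_eq_card_adj:
  assumes "simple_graph G"
  shows "degree G v = card {u. adj G v u}"
proof -
  have "{e \<in> edges G. v \<in> e} = (\<lambda>u. {v, u}) ` {u. adj G v u}"
  proof (intro equalityI subsetI)
    fix e assume e: "e \<in> {e \<in> edges G. v \<in> e}"
    then obtain x y where "e = {x, y}" "adj G x y" using assms by (auto elim: edgeE)
    with e show "e \<in> (\<lambda>u. {v, u}) ` {u. adj G v u}"
      by (auto simp: adj_sym insert_commute)
  qed (auto simp: adj_def)
  moreover have "inj_on (\<lambda>u. {v, u}) {u. adj G v u}"
    by (auto simp: inj_on_def doubleton_eq_iff)
  ultimately show ?thesis by (simp add: degree_def card_image)
qed

lemma finite_adj:
  assumes "simple_graph G"
  shows "finite {u. adj G v u}"
proof (rule finite_subset)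
  show "{u. adj G v u} \<subseteq> verts G" using adj_verts[OF assms] by blast
  show "finite (verts G)" using assms by (simp add: simple_graph_def)
qed

lemma connected_closed_set:
  assumes "connected_graph G" "v \<in> verts G" "v \<in> S" "\<And>x y. x \<in> S \<Longrightarrow> adj G x y \<Longrightarrow> y \<in> S"
  shows "verts G \<subseteq> S"
proof
  fix w assume "w \<in> verts G"
  with assms(1,2) have "(adj G)\<^sup>*\<^sup>* v w" by (auto simp: connected_graph_def)
  then show "w \<in> S" by (induction rule: rtranclp_induct) (use assms(3,4) in auto)
qed

section \<open>Trees have one edge fewer than vertices\<close>

text \<open>The first vertex of a longest path works: by maximality all its neighbours lie on the
  path, and a neighbour other than the second vertex would close a cycle with an initial segment of
  the path.\<close>

lemma acyclic_low_degree:
  assumes G: "simple_graph G" and acyc: "\<nexists>p. is_cycle G p"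
  obtains v where "v \<in> verts G" "degree G v \<le> 1"
proof -
  define P where "P = {p. p \<noteq> [] \<and> distinct p \<and> set p \<subseteq> verts G \<and>
    (\<forall>i. Suc i < length p \<longrightarrow> adj G (p ! i) (p ! Suc i))}"
  from G have fin: "finite (verts G)" and ne: "verts G \<noteq> {}" by (auto simp: simple_graph_def)
  have bound: "length p \<le> card (verts G)" if "p \<in> P" for p
    using that fin card_mono[of "verts G" "set p"] by (auto simp: P_def distinct_card)
  from ne obtain r where "r \<in> verts G" by auto
  then have "[r] \<in> P" by (auto simp: P_def)
  then obtain p where p: "p \<in> P" and max: "\<And>q. q \<in> P \<Longrightarrow> length q \<le> length p"
    using ex_has_greatest_nat[of "\<lambda>p. p \<in> P" "[r]" length "Suc (card (verts G))"] bound
    by (auto simp: less_Suc_eq_le)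
  then obtain x xs where pxs: "p = x # xs" by (cases p) (auto simp: P_def)
  have ext: "y \<in> set p" if "adj G x y" for y
  proof (rule ccontr)
    assume "y \<notin> set p"
    moreover have "adj G ((y # p) ! i) ((y # p) ! Suc i)" if "Suc i < length (y # p)" for i
      using that \<open>adj G x y\<close> p pxs by (cases i) (auto simp: P_def adj_sym)
    ultimately have "y # p \<in> P" using p adj_verts[OF G that] by (auto simp: P_def)
    with max show False by fastforce
  qed
  \<comment> \<open>If \<open>p\<close> has a single element, then \<open>p ! 1\<close> is
    unspecified, but \<open>x\<close> has no neighbour and the claim is vacuous.\<close>
  have "y = p ! 1" if xy: "adj G x y" for y
  proof (rule ccontr)
    assume y: "y \<noteq> p ! 1"
    obtain i where i: "i < length p" "p ! i = y" using ext[OF xy] by (auto simp: in_set_conv_nth)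
    have "i \<noteq> 0" using i pxs adj_verts[OF G xy] by (cases i) auto
    with y i have i2: "i \<ge> 2" by (cases i; cases "i - 1") auto
    \<comment> \<open>This segment runs from \<open>x\<close> to \<open>y\<close>, and the edge
      between them closes it; \<open>i \<ge> 2\<close> gives the three vertices that
      \<open>is_cycle\<close> demands.\<close>
    let ?c = "take (Suc i) p"
    have len: "length ?c = Suc i" using i by simp
    have "adj G (?c ! l) (?c ! ((l + 1) mod Suc i))" if "l < Suc i" for l
    proof (cases "l = i")
      case True
      then have "?c ! l = y" "?c ! 0 = x" using i by (simp_all add: pxs del: take_Suc_Cons)
      with True xy show ?thesis by (simp add: adj_sym)
    next
      case False
      with that have "l < i" by simp
      with p i show ?thesis by (auto simp: P_def)
    qed
    then have "is_cycle G ?c" using i2 len p by (auto simp: is_cycle_def P_def simp del: take_Suc)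
    with acyc show False by blast
  qed
  then have "{u. adj G x u} \<subseteq> {p ! 1}" by auto
  then have "degree G x \<le> 1"
    unfolding degree_eq_card_adj[OF G] using card_mono[of "{p ! 1}"] by simp
  moreover have "x \<in> verts G" using p pxs by (auto simp: P_def)
  ultimately show ?thesis using that by blast
qed

text \<open>Deleting a vertex of degree at most 1 leaves a simple acyclic graph and removes at most
  one edge. With the bound stated for forests, the induction requires no proof that the remainder is
  connected.\<close>

lemma acyclic_card_edges:
  assumes "simple_graph G" "\<nexists>p. is_cycle G p"
  shows "card (edges G) + 1 \<le> card (verts G)"
  using assms
proof (induction "card (verts G)" arbitrary: G rule: less_induct)
  case less
  note G = less.prems(1)
  have fin: "finite (verts G)" "verts G \<noteq> {}" using G by (auto simp: simple_graph_def)
  obtain v where v: "v \<in> verts G" "degree G v \<le> 1" using acyclic_low_degree less.prems by blast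
  show ?case
  proof (cases "verts G = {v}")
    case True
    have "edges G = {}"
    proof (rule ccontr)
      assume "edges G \<noteq> {}"
      then obtain e where e: "e \<in> edges G" by auto
      show False by (rule edgeE[OF G e]) (use True in auto)
    qed
    with True show ?thesis by simp
  next
    case False
    define H where "H = \<lparr>verts = verts G - {v}, edges = {e \<in> edges G. v \<notin> e}\<rparr>"
    have H: "simple_graph H" using G False v by (auto simp: H_def simple_graph_def)
    have "\<nexists>p. is_cycle H p"
      using less.prems(2) by (auto simp: is_cycle_def H_def adj_def)
    moreover have c: "card (verts H) = card (verts G) - 1" "card (verts G) > 0"
      using v fin by (auto simp: H_def card_gt_0_iff)
    ultimately have "card (edges H) + 1 \<le> card (verts H)" using less.hyps[of H] H by auto
    moreover have "edges G = edges H \<union> {e \<in> edges G. v \<in> e}" by (auto simp: H_def)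
    then have "card (edges G) \<le> card (edges H) + degree G v"
      unfolding degree_def by (metis card_Un_le)
    ultimately show ?thesis using c v by linarith
  qed
qed

text \<open>Each vertex other than a root \<open>r\<close> has a neighbour \<open>p v\<close> nearer
  to \<open>r\<close>. As the distance drops strictly from \<open>v\<close> to \<open>p v\<close>,
  no edge \<open>{p v, v}\<close> arises from two vertices, so the edges are at least as many as the
  non-root vertices.\<close>

lemma connected_card_edges:
  assumes G: "simple_graph G" and conn: "connected_graph G"
  shows "card (verts G) \<le> card (edges G) + 1"
proof -
  obtain r where r: "r \<in> verts G" using G by (auto simp: simple_graph_def)
  define d where "d v = (LEAST m. (adj G ^^ m) r v)" for v
  have ex: "\<exists>m. (adj G ^^ m) r v" if "v \<in> verts G" for v
    using conn r that by (auto simp: connected_graph_def rtranclp_power)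
  have "\<exists>u. adj G u v \<and> d u < d v" if v: "v \<in> verts G - {r}" for v
  proof -
    have dv: "(adj G ^^ d v) r v" unfolding d_def using ex v by (auto intro: LeastI_ex)
    with v obtain m where m: "d v = Suc m" by (cases "d v") auto
    with dv obtain u where u: "(adj G ^^ m) r u" "adj G u v" by auto
    then have "d u \<le> m" unfolding d_def by (auto intro: Least_le)
    with u m show ?thesis by auto
  qed
  then obtain p where p: "\<And>v. v \<in> verts G - {r} \<Longrightarrow> adj G (p v) v \<and> d (p v) < d v"
    by metis
  have "inj_on (\<lambda>v. {p v, v}) (verts G - {r})"
  proof (rule inj_onI)
    fix v w assume "v \<in> verts G - {r}" "w \<in> verts G - {r}" "{p v, v} = {p w, w}"
    then show "v = w" using p[of v] p[of w] by (auto simp: doubleton_eq_iff)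
  qed
  moreover have "(\<lambda>v. {p v, v}) ` (verts G - {r}) \<subseteq> edges G" using p by (auto simp: adj_def)
  ultimately have "card (verts G - {r}) \<le> card (edges G)"
    using finite_edges[OF G] by (metis card_image card_mono)
  then show ?thesis using r G by (simp add: simple_graph_def)
qed

lemma tree_card_edges:
  assumes "is_tree T"
  shows "card (verts T) = card (edges T) + 1"
  using assms acyclic_card_edges[of T] connected_card_edges[of T]
  by (simp add: is_tree_def)

text \<open>Double counting of the incidences between edges and vertices of degree
  \<open>i\<close>.\<close>

lemma degree_count:
  assumes G: "simple_graph G"
  shows "i * num_deg G i = (\<Sum>e\<in>edges G. card {v \<in> e. degree G v = i})"
proof -
  let ?V = "{v \<in> verts G. degree G v = i}"
  have fin: "finite ?V" using G by (simp add: simple_graph_def)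
  have "i * num_deg G i = (\<Sum>v\<in>?V. card {e \<in> edges G. v \<in> e})"
    by (simp add: num_deg_def degree_def)
  also have "\<dots> = (\<Sum>v\<in>?V. \<Sum>e\<in>edges G. if v \<in> e then 1 else 0)"
    using finite_edges[OF G] by (simp add: sum.If_cases Int_def)
  also have "\<dots> = (\<Sum>e\<in>edges G. \<Sum>v\<in>?V. if v \<in> e then 1 else 0)"
    by (rule sum.swap)
  also have "\<dots> = (\<Sum>e\<in>edges G. card {v \<in> e. degree G v = i})"
  proof (rule sum.cong[OF refl])
    fix e assume "e \<in> edges G"
    then have "e \<subseteq> verts G" using G by (auto simp: simple_graph_def)
    then have "{v \<in> verts G. degree G v = i} \<inter> {v. v \<in> e} = {v \<in> e. degree G v = i}" by auto
    then show "(\<Sum>v\<in>?V. if v \<in> e then 1 else 0) = card {v \<in> e. degree G v = i}"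
      using fin by (simp add: sum.If_cases)
  qed
  finally show ?thesis .
qed

subsection \<open>The irregularity of a member of the family\<close>

text \<open>The set behind \<open>num_edges_deg\<close>, named so that the edge set can be
  partitioned by type.\<close>

definition edges_deg :: "'a sgraph \<Rightarrow> nat \<Rightarrow> nat \<Rightarrow> 'a set set" where
  "edges_deg G i j = {e \<in> edges G. \<exists>u v. e = {u, v} \<and> degree G u = i \<and> degree G v = j}"

lemma num_edges_deg_eq: "num_edges_deg G i j = card (edges_deg G i j)"
  by (simp add: num_edges_deg_def edges_deg_def)

lemma edges_deg_subset: "edges_deg G i j \<subseteq> edges G"
  by (auto simp: edges_deg_def)

lemma edges_deg_disjoint:
  assumes "(i, j) \<noteq> (k, l)" "(i, j) \<noteq> (l, k)"
  shows "edges_deg G i j \<inter> edges_deg G k l = {}"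
  using assms by (auto simp: edges_deg_def doubleton_eq_iff)

text \<open>Evaluates the summands of \<open>degree_count\<close>; an edge with both ends of degree
  \<open>l\<close> counts twice.\<close>

lemma card_endpoints_edges_deg:
  assumes "simple_graph G" "e \<in> edges_deg G i j"
  shows "card {v \<in> e. degree G v = l} = of_bool (i = l) + of_bool (j = l)"
proof -
  obtain u v where uv: "e = {u, v}" "degree G u = i" "degree G v = j" "e \<in> edges G"
    using assms(2) by (auto simp: edges_deg_def)
  then have "u \<noteq> v" using adj_verts[OF assms(1), of u v] by (auto simp: adj_def)
  have "{v \<in> e. degree G v = l} = (if i = l then {u} else {}) \<union> (if j = l then {v} else {})"
    using uv by auto
  with \<open>u \<noteq> v\<close> show ?thesis by simp
qed

lemma edge_contrib_edges_deg:
  assumes "e \<in> edges_deg G i j"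
  shows "edge_contrib G e = (int i - int j)\<^sup>2"
  using assms by (auto simp: edges_deg_def)

text \<open>Only three edge types occur in either case of the counting below. The sum is taken with
  three choices of \<open>f\<close>: the number of ends of a given degree, the constant 1 and
  \<open>edge_contrib\<close>, hence the values in a semiring covering both \<open>nat\<close> and
  \<open>int\<close>.\<close>

lemma edge_types_sum:
  fixes f :: "'a set \<Rightarrow> 'c :: comm_semiring_1"
  assumes "simple_graph G" "edges G = edges_deg G i j \<union> edges_deg G k l \<union> edges_deg G p q"
    and "edges_deg G i j \<inter> edges_deg G k l = {}" "edges_deg G i j \<inter> edges_deg G p q = {}"
      "edges_deg G k l \<inter> edges_deg G p q = {}"
    and "\<And>e. e \<in> edges_deg G i j \<Longrightarrow> f e = x" "\<And>e. e \<in> edges_deg G k l \<Longrightarrow> f e = y"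
      "\<And>e. e \<in> edges_deg G p q \<Longrightarrow> f e = z"
  shows "(\<Sum>e\<in>edges G. f e) = of_nat (num_edges_deg G i j) * x + of_nat (num_edges_deg G k l) * y
    + of_nat (num_edges_deg G p q) * z"
proof -
  have fin: "finite (edges_deg G a b)" for a b
    using finite_edges[OF assms(1)] by (simp add: edges_deg_def)
  have "(\<Sum>e\<in>edges G. f e) = (\<Sum>e\<in>edges_deg G i j. f e) + (\<Sum>e\<in>edges_deg G k l. f e)
      + (\<Sum>e\<in>edges_deg G p q. f e)"
    unfolding assms(2) using assms(3-5) fin by (subst sum.union_disjoint; auto simp: sum.union_disjoint)
  also have "\<dots> = (\<Sum>e\<in>edges_deg G i j. x) + (\<Sum>e\<in>edges_deg G k l. y) + (\<Sum>e\<in>edges_deg G p q. z)"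
    using assms(6-8) by (simp cong: sum.cong)
  finally show ?thesis by (simp add: num_edges_deg_eq)
qed

section \<open>Local structure near leaves\<close>

lemma adj_degree_pos:
  assumes "simple_graph G" "adj G u v"
  shows "degree G u > 0"
  using assms finite_adj[OF assms(1)] by (auto simp: degree_eq_card_adj card_gt_0_iff)

lemma connected_degree_pos:
  assumes "simple_graph G" "connected_graph G" "card (verts G) > 1" "v \<in> verts G"
  shows "degree G v > 0"
proof (rule ccontr)
  assume "\<not> degree G v > 0"
  then have "\<not> adj G v u" for u using adj_degree_pos[OF assms(1), of v u] by auto
  then have "verts G \<subseteq> {v}" using connected_closed_set[OF assms(2,4), of "{v}"] by auto
  with assms(3) show False using card_mono[of "{v}" "verts G"] by simp
qed

lemma degree_1_neighbours:
  assumes "simple_graph G" "degree G u = 1" "adj G u v"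
  shows "adj G u x \<longleftrightarrow> x = v"
proof -
  obtain y where "\<And>x. adj G u x \<longleftrightarrow> x = y"
    using assms(1,2) by (auto simp: degree_eq_card_adj card_1_singleton_iff set_eq_iff)
  with assms(3) show ?thesis by auto
qed

lemma degree_2_neighbours:
  assumes "simple_graph G" "degree G u = 2" "adj G u v"
  obtains w where "w \<noteq> v" "\<And>x. adj G u x \<longleftrightarrow> x = v \<or> x = w"
proof -
  obtain y z where yz: "{x. adj G u x} = {y, z}" "y \<noteq> z"
    using assms(1,2) by (auto simp: degree_eq_card_adj card_2_iff)
  with assms(3) have "v = y \<or> v = z" by auto
  with yz that[of y] that[of z] show ?thesis by blast
qed

text \<open>If \<open>v\<close> had degree 1, then \<open>{u, v}\<close> would be the whole graph.
  If it had degree 2 and \<open>w\<close> as its other neighbour, then either \<open>w\<close> is a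
  leaf and \<open>{u, v, w}\<close> is the whole graph, or \<open>v\<close> is an internal leaf of
  degree 2.\<close>

lemma leaf_neighbour_degree:
  assumes G: "simple_graph G" "connected_graph G" "card (verts G) \<ge> 4"
    and il: "\<And>v. internal_leaf G v \<Longrightarrow> degree G v \<noteq> 2"
    and uv: "adj G u v" "degree G u = 1"
  shows "degree G v \<ge> 3"
proof (rule ccontr)
  assume "\<not> degree G v \<ge> 3"
  moreover have vu: "adj G v u" and V: "u \<in> verts G" "v \<in> verts G" "u \<noteq> v"
    using adj_verts[OF G(1) uv(1)] uv(1) by (auto simp: adj_sym)
  moreover have "degree G v > 0" using adj_degree_pos[OF G(1) vu] .
  ultimately consider "degree G v = 1" | "degree G v = 2" by linarith
  then show False
  proof cases
    case 1
    have "verts G \<subseteq> {u, v}"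
      by (rule connected_closed_set[OF G(2) V(1)])
        (use degree_1_neighbours[OF G(1) uv(2) uv(1)] degree_1_neighbours[OF G(1) 1 vu] in auto)
    then have "card (verts G) \<le> card {u, v}" by (intro card_mono) auto
    with G(3) show False by (simp add: card_insert_if split: if_splits)
  next
    case 2
    obtain w where w: "w \<noteq> u" "\<And>x. adj G v x \<longleftrightarrow> x = u \<or> x = w"
      using degree_2_neighbours[OF G(1) 2 vu] by blast
    then have vw: "adj G v w" by simp
    then have wv: "adj G w v" by (simp add: adj_sym)
    show False
    proof (cases "degree G w = 1")
      case True
      have "verts G \<subseteq> {u, v, w}"
        by (rule connected_closed_set[OF G(2) V(1)])
          (use degree_1_neighbours[OF G(1) uv(2) uv(1)] degree_1_neighbours[OF G(1) True wv] w in auto)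
      then have "card (verts G) \<le> card {u, v, w}" by (intro card_mono) auto
      with G(3) show False by (simp add: card_insert_if split: if_splits)
    next
      case False
      then have "degree G w > 1" using adj_degree_pos[OF G(1) wv] by linarith
      then have "{x \<in> verts G. adj G v x \<and> degree G x > 1} = {w}"
        using w uv(2) adj_verts[OF G(1) vw] by auto
      then have "internal_leaf G v" using V 2 by (simp add: internal_leaf_def)
      with il 2 show False by blast
    qed
  qed
qed

lemma degree_le_max_degree:
  assumes "simple_graph G" "v \<in> verts G"
  shows "degree G v \<le> max_degree G"
  using assms by (auto simp: max_degree_def simple_graph_def)

lemma div_mod_eqI:
  fixes m k i j d :: nat
  assumes "d * m + i = d * k + j" "i < d" "j < d"
  shows "m = k" "i = j"
proof -
  have "(d * m + i) div d = m" "(d * m + i) mod d = i" using assms(2) by auto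
  moreover have "(d * k + j) div d = k" "(d * k + j) mod d = j" using assms(3) by auto
  ultimately show "m = k" "i = j" using assms(1) by simp_all
qed

text \<open>The factors of \<open>(int \<Delta> - 1)\<^sup>2\<close> and
  \<open>(int \<Delta> - 2)\<^sup>2\<close> are the numbers of edges of types
  \<open>(1, \<Delta>)\<close> and \<open>(2, \<Delta>)\<close>. For \<open>j \<le> 2\<close> all
  other edges have type \<open>(2, 2)\<close> and contribute 0; for \<open>j \<ge> 3\<close> the
  last summand belongs to the \<open>j\<close> edges at the vertex of degree
  \<open>j\<close>.\<close>

definition sigma_value :: "nat \<Rightarrow> nat \<Rightarrow> nat \<Rightarrow> int" where
  "sigma_value \<Delta> k j = (if j \<le> 2
     then ((int \<Delta> - 2) * int k + 2) * (int \<Delta> - 1)\<^sup>2 + (2 * int k - 2) * (int \<Delta> - 2)\<^sup>2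
     else ((int \<Delta> - 2) * int k + int j) * (int \<Delta> - 1)\<^sup>2 + (2 * int k - int j) * (int \<Delta> - 2)\<^sup>2
       + int j * (int j - 2)\<^sup>2)"

text \<open>The ends have degree 1, 2 or \<Delta>. Two ends of degree \<Delta> are excluded by
  \<open>num_edges_deg T \<Delta> \<Delta> = 0\<close>, and a leaf has a neighbour of degree at
  least 3, hence \<Delta>.\<close>

lemma tree_family_edge:
  assumes T: "T \<in> tree_family n \<Delta>" and \<Delta>: "\<Delta> \<ge> 3" and n: "n \<ge> 4"
    and e: "e \<in> edges T" and nomid: "\<And>v. v \<in> e \<Longrightarrow> degree T v \<notin> {3..\<Delta> - 1}"
  shows "e \<in> edges_deg T 1 \<Delta> \<union> edges_deg T 2 \<Delta> \<union> edges_deg T 2 2"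
proof -
  have tree: "simple_graph T" "connected_graph T" and cardV: "card (verts T) = n"
    and maxd: "max_degree T = \<Delta>" and il: "\<And>v. internal_leaf T v \<Longrightarrow> degree T v = \<Delta>"
    and dd: "num_edges_deg T \<Delta> \<Delta> = 0"
    using T by (auto simp: tree_family_def is_tree_def)
  obtain u v where uv: "e = {u, v}" "u \<in> verts T" "v \<in> verts T" "adj T u v"
    using edgeE[OF tree(1) e] by metis
  have vu: "adj T v u" using uv by (simp add: adj_sym)
  have deg: "degree T x = 1 \<or> degree T x = 2 \<or> degree T x = \<Delta>" if "x \<in> {u, v}" for x
  proof -
    have "degree T x > 0" "degree T x \<le> \<Delta>"
      using that adj_degree_pos[OF tree(1)] uv vu degree_le_max_degree[OF tree(1), of x] maxd by auto
    with nomid[of x] that uv(1) show ?thesis by auto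
  qed
  have leaf: "degree T y \<ge> 3" if "adj T x y" "degree T x = 1" for x y
    by (rule leaf_neighbour_degree[OF tree _ _ that]) (use cardV n il \<Delta> in force)+
  have "edges_deg T \<Delta> \<Delta> = {}"
    using dd finite_edges[OF tree(1)] by (simp add: num_edges_deg_eq edges_deg_def)
  then have "\<not> (degree T u = \<Delta> \<and> degree T v = \<Delta>)"
    using e uv(1) by (auto simp: edges_deg_def)
  then consider "degree T u = 1" "degree T v = \<Delta>" | "degree T v = 1" "degree T u = \<Delta>"
    | "degree T u = 2" "degree T v = \<Delta>" | "degree T v = 2" "degree T u = \<Delta>"
    | "degree T u = 2" "degree T v = 2"
    using deg[of u] deg[of v] leaf[OF uv(4)] leaf[OF vu] by fastforce
  then show ?thesis
    using e uv(1) by cases (auto simp: edges_deg_def doubleton_eq_iff)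
qed

lemma sigma_irr_tree_family:
  fixes T :: "'a sgraph"
  assumes T: "T \<in> tree_family n \<Delta>" and \<Delta>: "\<Delta> \<ge> 4" and n: "n = k * \<Delta> + 1 + j"
    and k: "k \<ge> 1" and j: "1 \<le> j" "j \<le> \<Delta> - 1"
  shows "sigma_irr T = sigma_value \<Delta> k j"
proof -
  have tree: "is_tree T" and cardV: "card (verts T) = n" and maxd: "max_degree T = \<Delta>"
    and m22: "num_edges_deg T 2 2 \<le> 2"
    and mid: "(\<Sum>i = 3..\<Delta> - 1. num_deg T i) \<le> 1"
    and m22_0: "num_edges_deg T 2 2 = 0 \<longleftrightarrow> (\<exists>a. unique_mid_degree T \<Delta> a)"
    and ma2: "\<And>a. num_edges_deg T 2 2 = 0 \<Longrightarrow> unique_mid_degree T \<Delta> a \<Longrightarrow> num_edges_deg T a 2 = a"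
    using T by (auto simp: tree_family_def)
  then have G: "simple_graph T" "connected_graph T" by (auto simp: is_tree_def)
  then have finV: "finite (verts T)" by (simp add: simple_graph_def)
  have "k * \<Delta> \<ge> \<Delta>" using k by simp
  then have n4: "n \<ge> 4" using n \<Delta> by linarith
  define M where "M = {v \<in> verts T. degree T v \<in> {3..\<Delta> - 1}}"
  have "verts T = {v \<in> verts T. degree T v = 1} \<union> {v \<in> verts T. degree T v = 2}
      \<union> {v \<in> verts T. degree T v = \<Delta>} \<union> M"
    using connected_degree_pos[OF G] cardV n4 degree_le_max_degree[OF G(1)] maxd
    by (fastforce simp: M_def)
  moreover have "card ({v \<in> verts T. degree T v = 1} \<union> {v \<in> verts T. degree T v = 2}
      \<union> {v \<in> verts T. degree T v = \<Delta>} \<union> M) = num_deg T 1 + num_deg T 2 + num_deg T \<Delta> + card M"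
    unfolding num_deg_def using finV \<Delta> by (subst card_Un_disjoint; auto simp: M_def card_Un_disjoint)+
  ultimately have V: "n = num_deg T 1 + num_deg T 2 + num_deg T \<Delta> + card M"
    using cardV by simp
  have cardM: "card M = (\<Sum>i = 3..\<Delta> - 1. num_deg T i)"
  proof -
    have "M = (\<Union>i\<in>{3..\<Delta> - 1}. {v \<in> verts T. degree T v = i})" by (auto simp: M_def)
    also have "card \<dots> = (\<Sum>i = 3..\<Delta> - 1. num_deg T i)" unfolding num_deg_def
      by (rule card_UN_disjoint) (use finV in auto)
    finally show ?thesis .
  qed
  have E: "n = card (edges T) + 1" using tree_card_edges[OF tree] cardV by simp
  show ?thesis
  proof (cases "num_edges_deg T 2 2 = 0")
    case False
    \<comment> \<open>A sum of naturals equal to 1 has exactly one nonzero summand; its index would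
      satisfy \<open>unique_mid_degree\<close>, which forces
      \<open>num_edges_deg T 2 2 = 0\<close>.\<close>
    have "(\<Sum>i = 3..\<Delta> - 1. num_deg T i) \<noteq> 1"
    proof
      assume s1: "(\<Sum>i = 3..\<Delta> - 1. num_deg T i) = 1"
      then obtain a where "a \<in> {3..\<Delta> - 1}" "num_deg T a = 1"
        by (auto simp: sum_eq_Suc0_iff)
      with s1 have "unique_mid_degree T \<Delta> a" by (simp add: unique_mid_degree_def)
      with m22_0 False show False by blast
    qed
    with mid cardM have M0: "card M = 0" by linarith
    with finV have "M = {}" by (simp add: M_def)
    have "e \<in> edges_deg T 1 \<Delta> \<union> edges_deg T 2 \<Delta> \<union> edges_deg T 2 2" if "e \<in> edges T" for e
    proof (rule tree_family_edge[OF T _ n4 that])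
      fix v assume "v \<in> e"
      then have "v \<in> verts T" "v \<notin> M" using that G(1) \<open>M = {}\<close> by (auto simp: simple_graph_def)
      then show "degree T v \<notin> {3..\<Delta> - 1}" by (simp add: M_def)
    qed (use \<Delta> in simp)
    then have edg: "edges T = edges_deg T 1 \<Delta> \<union> edges_deg T 2 \<Delta> \<union> edges_deg T 2 2"
      by (auto simp: edges_deg_def)
    have disj: "edges_deg T 1 \<Delta> \<inter> edges_deg T 2 \<Delta> = {}" "edges_deg T 1 \<Delta> \<inter> edges_deg T 2 2 = {}"
      "edges_deg T 2 \<Delta> \<inter> edges_deg T 2 2 = {}"
      using \<Delta> by (auto intro!: edges_deg_disjoint)
    let ?p = "num_edges_deg T 1 \<Delta>" and ?q = "num_edges_deg T 2 \<Delta>" and ?r = "num_edges_deg T 2 2"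
    have cnt: "l * num_deg T l = ?p * (of_bool (1 = l) + of_bool (\<Delta> = l))
        + ?q * (of_bool (2 = l) + of_bool (\<Delta> = l)) + ?r * (of_bool (2 = l) + of_bool (2 = l))" for l
      unfolding degree_count[OF G(1)]
      using edge_types_sum[OF G(1) edg disj, of "\<lambda>e. card {v \<in> e. degree T v = l}"]
        card_endpoints_edges_deg[OF G(1)] by simp
    have c: "num_deg T 1 = ?p" "2 * num_deg T 2 = ?q + 2 * ?r" "\<Delta> * num_deg T \<Delta> = ?p + ?q"
      using cnt[of 1] cnt[of 2] cnt[of \<Delta>] \<Delta> by auto
    have "card (edges T) = ?p + ?q + ?r"
      using edge_types_sum[OF G(1) edg disj, of "\<lambda>_. 1 :: nat" 1 1 1] by simp
    with E have E': "n = ?p + ?q + ?r + 1" by simp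
    \<comment> \<open>The vertex count and the edge count both express \<open>n\<close>; insert
      \<open>num_deg T 1 = ?p\<close> and \<open>num_deg T 2 = ?q / 2 + ?r\<close>.\<close>
    have q: "?q + 2 = 2 * num_deg T \<Delta>" using V c E' M0 by linarith
    then have eq: "\<Delta> * num_deg T \<Delta> + ?r = \<Delta> * k + j" using E' c n by (simp add: algebra_simps)
    \<comment> \<open>Both sides of \<open>eq\<close> are divisions of \<open>n - 1\<close> by
      \<Delta> with remainder. So \<open>num_deg T \<Delta> = k\<close> and \<open>?r = j\<close>,
      whence \<open>j \<le> 2\<close> and the first branch of \<open>sigma_value\<close>
      applies.\<close>
    have "?r < \<Delta>" "j < \<Delta>" using m22 j \<Delta> by simp_all
    note kj = div_mod_eqI[OF eq this]
    have "sigma_irr T = int ?p * (int \<Delta> - 1)\<^sup>2 + int ?q * (int \<Delta> - 2)\<^sup>2"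
      unfolding sigma_irr_def
      using edge_types_sum[OF G(1) edg disj, of "edge_contrib T" "(int 1 - int \<Delta>)\<^sup>2" "(int 2 - int \<Delta>)\<^sup>2" 0]
        edge_contrib_edges_deg[of _ T] by (simp add: power2_commute)
    moreover have q': "int ?q = 2 * int k - 2" using q kj by simp
    moreover have "int \<Delta> * int k = int ?p + int ?q"
      using c(3) kj by (metis of_nat_add of_nat_mult)
    then have "int ?p = (int \<Delta> - 2) * int k + 2" using q' by (simp add: algebra_simps)
    ultimately show ?thesis using kj m22 by (simp add: sigma_value_def)
  next
    case True
    then obtain a where a: "unique_mid_degree T \<Delta> a" using m22_0 by auto
    then have a3: "a \<ge> 3" "a \<le> \<Delta> - 1" and M1: "card M = 1" and na: "num_deg T a = 1"
      using cardM by (auto simp: unique_mid_degree_def)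
    have ea: "num_edges_deg T a 2 = a" using ma2[OF True a] .
    obtain w where w: "{v \<in> verts T. degree T v = a} = {w}"
      using na by (auto simp: num_deg_def card_1_singleton_iff)
    then have dw: "degree T w = a" by auto
    have "w \<in> M" using w a3 by (auto simp: M_def)
    with M1 have Mw: "M = {w}" by (metis card_1_singletonE singletonD)
    \<comment> \<open>Only \<open>w\<close> has degree \<open>a\<close>, so each edge of type
      \<open>(a, 2)\<close> contains \<open>w\<close>. Condition (5) provides \<open>a\<close> of
      them, as many as \<open>w\<close> has edges, so every neighbour of \<open>w\<close> has degree
      2.\<close>
    have "edges_deg T a 2 \<subseteq> {e \<in> edges T. w \<in> e}"
    proof
      fix e assume "e \<in> edges_deg T a 2"
      then obtain u v where uv: "e = {u, v}" "degree T u = a" "e \<in> edges T" by (auto simp: edges_deg_def)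
      then have "u \<in> verts T" using adj_verts[OF G(1), of u v] by (simp add: adj_def)
      with uv w show "e \<in> {e \<in> edges T. w \<in> e}" by auto
    qed
    then have inc: "edges_deg T a 2 = {e \<in> edges T. w \<in> e}"
      using finite_edges[OF G(1)] ea dw
      by (intro card_subset_eq) (auto simp: degree_def num_edges_deg_eq)
    have none: "edges_deg T 2 2 = {}"
      using True finite_edges[OF G(1)] by (simp add: num_edges_deg_eq edges_deg_def)
    have rest: "e \<in> edges_deg T 1 \<Delta> \<union> edges_deg T 2 \<Delta> \<union> edges_deg T 2 2"
      if "e \<in> edges T" "w \<notin> e" for e
    proof (rule tree_family_edge[OF T _ n4 that(1)])
      fix v assume "v \<in> e"
      then have "v \<in> verts T" "v \<notin> M" using that G(1) Mw by (auto simp: simple_graph_def)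
      then show "degree T v \<notin> {3..\<Delta> - 1}" by (simp add: M_def)
    qed (use \<Delta> in simp)
    have edg: "edges T = edges_deg T 1 \<Delta> \<union> edges_deg T 2 \<Delta> \<union> edges_deg T a 2"
    proof (intro equalityI subsetI)
      fix e assume "e \<in> edges T"
      then show "e \<in> edges_deg T 1 \<Delta> \<union> edges_deg T 2 \<Delta> \<union> edges_deg T a 2"
        using rest[of e] inc none by (cases "w \<in> e") auto
    qed (use edges_deg_subset in blast)
    have disj: "edges_deg T 1 \<Delta> \<inter> edges_deg T 2 \<Delta> = {}" "edges_deg T 1 \<Delta> \<inter> edges_deg T a 2 = {}"
      "edges_deg T 2 \<Delta> \<inter> edges_deg T a 2 = {}"
      using \<Delta> a3 by (auto intro!: edges_deg_disjoint)
    let ?p = "num_edges_deg T 1 \<Delta>" and ?q = "num_edges_deg T 2 \<Delta>"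
    have cnt: "l * num_deg T l = ?p * (of_bool (1 = l) + of_bool (\<Delta> = l))
        + ?q * (of_bool (2 = l) + of_bool (\<Delta> = l)) + a * (of_bool (a = l) + of_bool (2 = l))" for l
      unfolding degree_count[OF G(1)]
      using edge_types_sum[OF G(1) edg disj, of "\<lambda>e. card {v \<in> e. degree T v = l}"]
        card_endpoints_edges_deg[OF G(1)] ea by simp
    have c: "num_deg T 1 = ?p" "2 * num_deg T 2 = ?q + a" "\<Delta> * num_deg T \<Delta> = ?p + ?q"
      using cnt[of 1] cnt[of 2] cnt[of \<Delta>] \<Delta> a3 by auto
    have "card (edges T) = ?p + ?q + a"
      using edge_types_sum[OF G(1) edg disj, of "\<lambda>_. 1 :: nat" 1 1 1] ea by simp
    with E have E': "n = ?p + ?q + a + 1" by simp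
    \<comment> \<open>As in the first case, now with \<open>num_deg T 2 = (?q + a) / 2\<close>; the
      vertex \<open>w\<close> cancels the excess of vertices over edges.\<close>
    have q: "?q + a = 2 * num_deg T \<Delta>" using V c E' M1 by linarith
    then have eq: "\<Delta> * num_deg T \<Delta> + a = \<Delta> * k + j" using E' c n by (simp add: algebra_simps)
    have "a < \<Delta>" "j < \<Delta>" using a3 j \<Delta> by simp_all
    note kj = div_mod_eqI[OF eq this]
    have "sigma_irr T = int ?p * (int \<Delta> - 1)\<^sup>2 + int ?q * (int \<Delta> - 2)\<^sup>2 + int a * (int a - 2)\<^sup>2"
      unfolding sigma_irr_def
      using edge_types_sum[OF G(1) edg disj, of "edge_contrib T" "(int 1 - int \<Delta>)\<^sup>2" "(int 2 - int \<Delta>)\<^sup>2"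
          "(int a - int 2)\<^sup>2"]
        edge_contrib_edges_deg[of _ T] ea by (simp add: power2_commute)
    moreover have q': "int ?q = 2 * int k - int j" using q kj by simp
    moreover have "int \<Delta> * int k = int ?p + int ?q"
      using c(3) kj by (metis of_nat_add of_nat_mult)
    then have "int ?p = (int \<Delta> - 2) * int k + int j" using q' by (simp add: algebra_simps)
    ultimately show ?thesis using kj a3 by (simp add: sigma_value_def)
  qed
qed

subsection \<open>Construction of a member of the family\<close>

text \<open>A tree rooted at 0 if \<open>p v < v\<close> for every other vertex. Its edges then
  correspond to the non-root vertices, so degrees and edge types are counted over sets of
  numbers.\<close>

definition parent_graph :: "nat \<Rightarrow> (nat \<Rightarrow> nat) \<Rightarrow> nat sgraph" where
  "parent_graph n p = \<lparr>verts = {..<n}, edges = (\<lambda>v. {p v, v}) ` {1..<n}\<rparr>"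

lemma verts_parent_graph [simp]: "verts (parent_graph n p) = {..<n}"
  by (simp add: parent_graph_def)

lemma adj_parent_graph:
  "adj (parent_graph n p) u v \<longleftrightarrow> (v \<in> {1..<n} \<and> u = p v) \<or> (u \<in> {1..<n} \<and> v = p u)"
  by (auto simp: adj_def parent_graph_def doubleton_eq_iff)

context
  fixes n :: nat and p :: "nat \<Rightarrow> nat"
  assumes n: "n > 0" and p: "\<And>v. 0 < v \<Longrightarrow> v < n \<Longrightarrow> p v < v"
begin

lemma simple_parent_graph: "simple_graph (parent_graph n p)"
proof -
  have "p v < n \<and> card {p v, v} = 2" if "v \<in> {1..<n}" for v
    using p[of v] that by simp
  then show ?thesis using n by (auto simp: simple_graph_def parent_graph_def)
qed

text \<open>Iterating \<open>p\<close> leads from any vertex down to 0. The largest vertex of a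
  cycle would have two distinct smaller neighbours, but its parent is the only smaller one.\<close>

lemma tree_parent_graph: "is_tree (parent_graph n p)"
proof -
  let ?G = "parent_graph n p"
  have root: "(adj ?G)\<^sup>*\<^sup>* 0 v" if "v < n" for v
    using that
  proof (induction v rule: less_induct)
    case (less v)
    show ?case
    proof (cases "v = 0")
      case False
      then have "(adj ?G)\<^sup>*\<^sup>* 0 (p v)" using less p[of v] by simp
      moreover have "adj ?G (p v) v" using False less.prems by (simp add: adj_parent_graph)
      ultimately show ?thesis by (rule rtranclp.rtrancl_into_rtrancl)
    qed simp
  qed
  have "symp (adj ?G)" by (auto intro!: sympI simp: adj_sym)
  then have "symp (adj ?G)\<^sup>*\<^sup>*" by (rule symp_rtranclp)
  then have "connected_graph ?G"
    using root unfolding connected_graph_def verts_parent_graph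
    by (meson lessThan_iff rtranclp_trans sympD)
  moreover have "\<not> is_cycle ?G c" for c
  proof
    assume c: "is_cycle ?G c"
    define L where "L = length c"
    have L: "L \<ge> 3" "distinct c" and step: "\<And>i. i < L \<Longrightarrow> adj ?G (c ! i) (c ! ((i + 1) mod L))"
      using c by (auto simp: is_cycle_def L_def)
    have "c \<noteq> []" using L by (auto simp: L_def)
    then have "Max (set c) \<in> set c" by (intro Max_in) auto
    then obtain i where i: "i < L" "c ! i = Max (set c)" by (auto simp: in_set_conv_nth L_def)
    \<comment> \<open>\<open>s\<close> and \<open>t\<close> are the positions cyclically after and
      before \<open>i\<close>; they differ because \<open>L \<ge> 3\<close>.\<close>
    define s where "s = (if i = L - 1 then 0 else i + 1)"
    define t where "t = (if i = 0 then L - 1 else i - 1)"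
    have st: "s < L" "t < L" "s \<noteq> t" "s \<noteq> i" "t \<noteq> i" using i L by (auto simp: s_def t_def)
    have "adj ?G (c ! i) (c ! s)"
      using step[of i] i L by (cases "i = L - 1") (auto simp: s_def)
    moreover have "adj ?G (c ! t) (c ! i)"
      using step[of t] i L by (cases "i = 0") (auto simp: t_def)
    moreover have "c ! s < c ! i" "c ! t < c ! i"
    proof -
      have "c ! l < c ! i" if "l < L" "l \<noteq> i" for l
      proof -
        have "c ! l \<le> c ! i" unfolding i(2) using that by (intro Max_ge) (auto simp: L_def)
        moreover have "c ! l \<noteq> c ! i" using that i(1) L by (simp add: nth_eq_iff_index_eq L_def)
        ultimately show ?thesis by simp
      qed
      with st show "c ! s < c ! i" "c ! t < c ! i" by auto
    qed
    ultimately have "c ! s = p (c ! i)" "c ! t = p (c ! i)"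
      using p[of "c ! s"] p[of "c ! t"] by (auto simp: adj_parent_graph)
    then show False using nth_eq_iff_index_eq[of c s t] st L by (simp add: L_def)
  qed
  ultimately show ?thesis by (simp add: is_tree_def simple_parent_graph)
qed

lemma degree_parent_graph:
  assumes "v < n"
  shows "degree (parent_graph n p) v = card {w \<in> {1..<n}. p w = v} + of_bool (v > 0)"
proof -
  have "{u. adj (parent_graph n p) v u} = {w \<in> {1..<n}. p w = v} \<union> (if v > 0 then {p v} else {})"
    using assms by (auto simp: adj_parent_graph)
  moreover have "p (p v) \<noteq> v" if "v > 0" "p v > 0"
    using p[of v] p[of "p v"] that assms by linarith
  ultimately show ?thesis
    by (auto simp: degree_eq_card_adj[OF simple_parent_graph])
qed

lemma num_edges_deg_parent_graph:
  assumes "\<And>v. v < n \<Longrightarrow> degree (parent_graph n p) v = d v"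
  shows "num_edges_deg (parent_graph n p) i j
    = card {v \<in> {1..<n}. d (p v) = i \<and> d v = j \<or> d (p v) = j \<and> d v = i}"
proof -
  let ?S = "{v \<in> {1..<n}. d (p v) = i \<and> d v = j \<or> d (p v) = j \<and> d v = i}"
  have d: "degree (parent_graph n p) v = d v" "degree (parent_graph n p) (p v) = d (p v)"
    if "v \<in> {1..<n}" for v
    using that assms p[of v] by auto
  have "{e \<in> edges (parent_graph n p). \<exists>u v. e = {u, v} \<and>
      degree (parent_graph n p) u = i \<and> degree (parent_graph n p) v = j} = (\<lambda>v. {p v, v}) ` ?S"
    using d by (fastforce simp: parent_graph_def doubleton_eq_iff)
  moreover have "inj_on (\<lambda>v. {p v, v}) ?S"
  proof (rule inj_onI)
    fix v w assume "v \<in> ?S" "w \<in> ?S" "{p v, v} = {p w, w}"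
    then show "v = w" using p[of v] p[of w] by (auto simp: doubleton_eq_iff)
  qed
  ultimately show ?thesis by (simp add: num_edges_deg_def card_image)
qed

end

section \<open>Attaching pendent vertices to a skeleton\<close>

text \<open>Used to hand out the pendent vertices, \<open>c i\<close> of them to each
  \<open>i\<close>. The induction assigns consecutive blocks of numbers to the elements of
  \<open>I\<close>.\<close>

lemma exists_map_fibre_cards:
  fixes c :: "'b \<Rightarrow> nat"
  assumes "finite I"
  shows "\<exists>f. \<forall>x < sum c I. f x \<in> I \<and> (\<forall>i\<in>I. card {x. x < sum c I \<and> f x = i} = c i)"
  using assms
proof (induction I)
  case (insert i F)
  then obtain f where f: "\<And>x. x < sum c F \<Longrightarrow> f x \<in> F"
    "\<And>l. l \<in> F \<Longrightarrow> sum c F > 0 \<Longrightarrow> card {x. x < sum c F \<and> f x = l} = c l"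
    by blast
  \<comment> \<open>The fibre clause stands in the scope of \<open>x < sum c F\<close> and says
    nothing when the sum is 0; in that case \<open>c l = 0\<close> and the fibre is empty.\<close>
  have f2: "card {x. x < sum c F \<and> f x = l} = c l" if "l \<in> F" for l
    using f(2)[OF that] that insert.hyps by (cases "sum c F = 0") auto
  have f_ne: "f x \<noteq> i" if "x < sum c F" for x using f(1)[OF that] insert.hyps by auto
  define g where "g x = (if x < sum c F then f x else i)" for x
  have "card {x. x < sum c (insert i F) \<and> g x = l} = c l" if "l \<in> insert i F" for l
  proof (cases "l = i")
    case True
    have "{x. x < sum c (insert i F) \<and> g x = l} = {sum c F..<sum c F + c i}"
      using True insert.hyps f_ne by (auto simp: g_def not_less)
    then show ?thesis using True by simp
  next
    case False
    then have "{x. x < sum c (insert i F) \<and> g x = l} = {x. x < sum c F \<and> f x = l}"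
      using insert.hyps by (auto simp: g_def)
    then show ?thesis using f2 that False by simp
  qed
  then show ?case using f(1) by (auto intro!: exI[of _ g] simp: g_def)
qed simp

text \<open>The pendent vertices are numbered from \<open>m\<close> on, after the vertices \<open>0, \<dots>, m - 1\<close>
  of a tree given by the parent function \<open>p\<close>; they fill up the degrees of the vertices
  in \<open>D\<close> to \<open>\<Delta>\<close>.\<close>

lemma tree_family_pendent_extension:
  fixes p s :: "nat \<Rightarrow> nat"
  assumes m: "m > 0" and p: "\<And>v. 0 < v \<Longrightarrow> v < m \<Longrightarrow> p v < v"
    and D: "D \<subseteq> {..<m}" "D \<noteq> {}"
    and s: "\<And>v. v < m \<Longrightarrow> card {w \<in> {1..<m}. p w = v} + of_bool (v > 0) = s v"
    and sD: "\<And>v. v \<in> D \<Longrightarrow> s v \<le> \<Delta>"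
    and snD: "\<And>v. v < m \<Longrightarrow> v \<notin> D \<Longrightarrow> 2 \<le> s v \<and> s v < \<Delta>"
    and indep: "\<And>v. 0 < v \<Longrightarrow> v \<in> D \<Longrightarrow> p v \<notin> D"
    and n: "n = m + (\<Sum>v\<in>D. \<Delta> - s v)" and \<Delta>: "\<Delta> \<ge> 3"
    and mid: "\<And>i. i \<in> {3..\<Delta> - 1} \<Longrightarrow> card {v \<in> {..<m} - D. s v = i} = of_bool (i = j)"
    and j: "1 \<le> j" "j < \<Delta>"
    and m22: "card {v \<in> {1..<m} - D. p v \<notin> D \<and> s (p v) = 2 \<and> s v = 2} = (if j \<le> 2 then j else 0)"
    and mj2: "j \<ge> 3 \<Longrightarrow> card {v \<in> {1..<m} - D. p v \<notin> D \<and>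
      (s (p v) = j \<and> s v = 2 \<or> s (p v) = 2 \<and> s v = j)} = j"
  shows "tree_family n \<Delta> \<noteq> ({} :: nat sgraph set)"
proof -
  have "finite D" using D by (auto intro: finite_subset)
  then obtain f where f: "\<And>x. x < n - m \<Longrightarrow> f x \<in> D"
    "\<And>v. v \<in> D \<Longrightarrow> n - m > 0 \<Longrightarrow> card {x. x < n - m \<and> f x = v} = \<Delta> - s v"
    using exists_map_fibre_cards[of D "\<lambda>v. \<Delta> - s v"] n by auto
  define q where "q v = (if v < m then p v else f (v - m))" for v
  have nm: "n \<ge> m" using n by simp
  have q: "q v < v" if "0 < v" "v < n" for v
    using that p[of v] f(1)[of "v - m"] D(1) by (force simp: q_def)
  have qD: "q v \<in> D" if "m \<le> v" "v < n" for v
    using that f(1)[of "v - m"] by (simp add: q_def)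
  define T where "T = parent_graph n q"
  have n0: "n > 0" using m nm by simp
  note pg = n0 q
  have tree: "is_tree T" unfolding T_def by (rule tree_parent_graph[OF pg])
  then have G: "simple_graph T" by (simp add: is_tree_def)
  have verts: "verts T = {..<n}" by (simp add: T_def)
  \<comment> \<open>\<open>s\<close> gives the degrees in the skeleton on \<open>{..<m}\<close>,
    \<open>d\<close> those after the pendent vertices are attached.\<close>
  define d where "d v = (if v \<in> D then \<Delta> else if v < m then s v else 1)" for v
  have fibre: "card {w \<in> {m..<n}. q w = v} = (if v \<in> D then \<Delta> - s v else 0)" for v
  proof -
    have "{w \<in> {m..<n}. q w = v} = (\<lambda>x. x + m) ` {x. x < n - m \<and> f x = v}"
    proof (intro equalityI subsetI)
      fix w assume "w \<in> {w \<in> {m..<n}. q w = v}"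
      then show "w \<in> (\<lambda>x. x + m) ` {x. x < n - m \<and> f x = v}"
        by (intro image_eqI[of _ _ "w - m"]) (auto simp: q_def)
    qed (auto simp: q_def)
    then have *: "card {w \<in> {m..<n}. q w = v} = card {x. x < n - m \<and> f x = v}"
      by (simp add: card_image)
    show ?thesis
    proof (cases "v \<in> D")
      case True
      show ?thesis
      proof (cases "n - m = 0")
        case True
        then have "\<Delta> - s v = 0" using n \<open>v \<in> D\<close> \<open>finite D\<close> by simp
        with True * show ?thesis by simp
      qed (use * f(2) True in simp)
    next
      case False
      then have "{x. x < n - m \<and> f x = v} = {}" using f(1) by auto
      with False * show ?thesis by simp
    qed
  qed
  have deg: "degree T v = d v" if "v < n" for v
  proof -
    have "{w \<in> {1..<n}. q w = v} = {w \<in> {1..<m}. q w = v} \<union> {w \<in> {m..<n}. q w = v}"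
      using m nm by auto
    then have "card {w \<in> {1..<n}. q w = v}
        = card {w \<in> {1..<m}. q w = v} + card {w \<in> {m..<n}. q w = v}"
      by (simp add: card_Un_disjoint disjoint_iff)
    also have "{w \<in> {1..<m}. q w = v} = {w \<in> {1..<m}. p w = v}" by (auto simp: q_def)
    finally have card_q: "card {w \<in> {1..<n}. q w = v}
        = card {w \<in> {1..<m}. p w = v} + card {w \<in> {m..<n}. q w = v}" .
    have "degree T v = card {w \<in> {1..<n}. q w = v} + of_bool (v > 0)"
      unfolding T_def by (rule degree_parent_graph[OF pg that])
    then have *: "degree T v = card {w \<in> {1..<m}. p w = v} + of_bool (v > 0)
        + (if v \<in> D then \<Delta> - s v else 0)"
      unfolding card_q fibre by simp
    show ?thesis
    proof (cases "v < m")
      case True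
      with * s sD show ?thesis by (simp add: d_def)
    next
      case False
      have "p w < m" if "w \<in> {1..<m}" for w using p[of w] that by simp
      with False have "{w \<in> {1..<m}. p w = v} = {}" by auto
      with * False m D(1) show ?thesis by (auto simp: d_def)
    qed
  qed
  have d_le: "d v \<le> \<Delta>" for v using snD[of v] \<Delta> by (auto simp: d_def)
  have d_D: "d v = \<Delta> \<longleftrightarrow> v \<in> D" for v using snD[of v] \<Delta> by (auto simp: d_def)
  have edg: "num_edges_deg T a b
    = card {v \<in> {1..<n}. d (q v) = a \<and> d v = b \<or> d (q v) = b \<and> d v = a}" for a b
    unfolding T_def by (rule num_edges_deg_parent_graph[OF pg]) (use deg T_def in auto)
  \<comment> \<open>Vertices with degrees from 2 to \<open>\<Delta> - 1\<close> all lie in the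
    skeleton outside \<open>D\<close>, so edges between such vertices can be counted there, as
    \<open>m22\<close> and \<open>mj2\<close> do.\<close>
  have inner: "{v \<in> {1..<n}. d (q v) = a \<and> d v = b \<or> d (q v) = b \<and> d v = a}
    = {v \<in> {1..<m} - D. p v \<notin> D \<and> (s (p v) = a \<and> s v = b \<or> s (p v) = b \<and> s v = a)}"
    if ab: "a \<in> {2..<\<Delta>}" "b \<in> {2..<\<Delta>}" for a b
  proof -
    have inner_D: "v < m \<and> v \<notin> D \<and> p v \<notin> D" if v: "v \<in> {1..<n}"
      "d (q v) = a \<and> d v = b \<or> d (q v) = b \<and> d v = a" for v
    proof -
      have "d v \<in> {2..<\<Delta>}" "d (q v) \<in> {2..<\<Delta>}" using v(2) ab by auto
      then have "v < m" "v \<notin> D" "q v \<notin> D" by (auto simp: d_def split: if_splits)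
      then show ?thesis by (simp add: q_def)
    qed
    have d_s: "d v = s v \<and> d (q v) = s (p v)" if "v \<in> {1..<m} - D" "p v \<notin> D" for v
      using that p[of v] by (auto simp: d_def q_def)
    show ?thesis (is "?L = ?R")
    proof (intro equalityI subsetI)
      fix v assume v: "v \<in> ?L"
      then have "v \<in> {1..<m} - D" "p v \<notin> D" using inner_D[of v] by auto
      with v d_s[of v] show "v \<in> ?R" by auto
    next
      fix v assume "v \<in> ?R"
      with d_s[of v] nm show "v \<in> ?L" by auto
    qed
  qed
  obtain x where "x \<in> D" using D by auto
  then have "x < n" "degree T x = \<Delta>" using D(1) nm deg d_D by auto
  then have maxd: "max_degree T = \<Delta>"
    unfolding max_degree_def verts using deg d_le by (intro Max_eqI) force+
  \<comment> \<open>A vertex of degree at least 2 but not \<Delta> lies in the skeleton outside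
    \<open>D\<close>. Pendent vertices hang on \<open>D\<close> only, so all its neighbours have
    degree above 1, and there are at least two of them.\<close>
  have il: "degree T v = \<Delta>" if "internal_leaf T v" for v
  proof (rule ccontr)
    assume ne: "degree T v \<noteq> \<Delta>"
    have v: "v < n" "degree T v \<ge> 2" "card {u \<in> verts T. adj T v u \<and> degree T u > 1} = 1"
      using that by (auto simp: internal_leaf_def verts)
    have vD: "v \<notin> D" using ne v deg d_D by auto
    then have vm: "v < m" using v deg[of v] by (auto simp: d_def split: if_splits)
    have "u \<in> verts T \<and> degree T u > 1" if "adj T v u" for u
    proof -
      have u: "u < n" using adj_verts[OF G that] verts by auto
      have "u < m"
      proof (rule ccontr)
        assume "\<not> u < m"
        then have "v = q u" "m \<le> u" using that vm q[of v] by (auto simp: T_def adj_parent_graph)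
        then show False using qD[of u] u vD by auto
      qed
      then have "d u > 1" using snD[of u] \<Delta> by (cases "u \<in> D") (simp_all add: d_def)
      with u deg[OF u] show ?thesis by (simp add: verts)
    qed
    then have "{u \<in> verts T. adj T v u \<and> degree T u > 1} = {u. adj T v u}" by auto
    with v show False by (simp add: degree_eq_card_adj[OF G])
  qed
  have "{v \<in> {1..<n}. d (q v) = \<Delta> \<and> d v = \<Delta> \<or> d (q v) = \<Delta> \<and> d v = \<Delta>} = {}"
    using indep D(1) by (auto simp: d_D q_def)
  then have DD: "num_edges_deg T \<Delta> \<Delta> = 0" by (simp add: edg)
  have mid': "num_deg T i = of_bool (i = j)" if "i \<in> {3..\<Delta> - 1}" for i
  proof -
    have "{v \<in> verts T. degree T v = i} = {v \<in> {..<m} - D. s v = i}"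
      using that deg nm \<Delta> by (auto simp: verts d_def split: if_splits)
    with mid[OF that] show ?thesis by (simp add: num_deg_def)
  qed
  have "(\<Sum>i = 3..\<Delta> - 1. num_deg T i) = (\<Sum>i = 3..\<Delta> - 1. if i = j then 1 else 0)"
    by (rule sum.cong) (simp_all add: mid')
  then have mid_sum: "(\<Sum>i = 3..\<Delta> - 1. num_deg T i) = of_bool (j \<ge> 3)"
    using j by auto
  have unique: "unique_mid_degree T \<Delta> a \<longleftrightarrow> a = j \<and> j \<ge> 3" for a
  proof (cases "a \<in> {3..\<Delta> - 1}")
    case True
    then show ?thesis by (simp add: unique_mid_degree_def mid_sum mid' del: atLeastAtMost_iff) (use True in auto)
  next
    case False
    then show ?thesis using j by (auto simp: unique_mid_degree_def)
  qed
  have "num_edges_deg T 2 2 = (if j \<le> 2 then j else 0)"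
    unfolding edg using inner[of 2 2] \<Delta> m22 by simp
  moreover have "num_edges_deg T j 2 = j" if "j \<ge> 3"
    unfolding edg using inner[of j 2] \<Delta> mj2 that j by simp
  ultimately have "T \<in> tree_family n \<Delta>"
    using tree maxd il DD mid_sum unique j by (auto simp: tree_family_def verts)
  then show ?thesis by blast
qed

section \<open>The two skeletons\<close>

text \<open>The skeleton is the path 0, 1, ..., 2k - 1, and \<open>D\<close> consists of its
  \<open>k\<close> vertices 0, 3, 5, ..., 2k - 1. Both ends lie in \<open>D\<close>, and 1, 2 are
  the only adjacent vertices outside \<open>D\<close>.\<close>

lemma tree_family_nonempty_1:
  assumes "\<Delta> \<ge> 3" "k \<ge> 2"
  shows "tree_family (k * \<Delta> + 2) \<Delta> \<noteq> ({} :: nat sgraph set)"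
proof -
  define D where "D = insert 0 ((\<lambda>i. 2 * i + 1) ` {1..<k})"
  define s :: "nat \<Rightarrow> nat" where "s v = (if v = 0 \<or> v = 2 * k - 1 then 1 else 2)" for v
  have D: "v \<in> D \<longleftrightarrow> v = 0 \<or> odd v \<and> 3 \<le> v \<and> v < 2 * k" for v
    by (auto simp: D_def image_iff elim!: oddE)
  have D_sub: "D \<subseteq> {..<2 * k}" "D \<noteq> {}" using assms by (auto simp: D_def)
  have s_odd: "s (2 * i + 1) = (if i = k - 1 then 1 else 2)" if "i \<in> {1..<k}" for i
    using that by (auto simp: s_def)
  show ?thesis
  proof (rule tree_family_pendent_extension[where m = "2 * k" and p = "\<lambda>v. v - 1" and D = D
        and s = s and j = 1])
    fix v assume v: "v < 2 * k"
    have "{w \<in> {1..<2 * k}. w - 1 = v} = (if v = 2 * k - 1 then {} else {Suc v})"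
      using v by auto
    then show "card {w \<in> {1..<2 * k}. w - 1 = v} + of_bool (v > 0) = s v"
      using assms v by (auto simp: s_def)
  next
    have "(\<Sum>v\<in>D. \<Delta> - s v) = (\<Delta> - 1) + (\<Sum>i\<in>{1..<k}. \<Delta> - s (2 * i + 1))"
      unfolding D_def by (subst sum.insert) (auto simp: sum.reindex inj_on_def s_def)
    \<comment> \<open>The vertex with \<open>i = k - 1\<close> ends the path and takes one more
      pendent vertex than the others.\<close>
    also have "(\<Sum>i\<in>{1..<k}. \<Delta> - s (2 * i + 1)) = (\<Sum>i\<in>{1..<k}. (\<Delta> - 2) + (if k - 1 = i then 1 else 0))"
      by (rule sum.cong) (use s_odd assms in auto)
    also have "\<dots> = (k - 1) * (\<Delta> - 2) + 1" using assms by (subst sum.distrib) simp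
    finally have "2 * k + (\<Sum>v\<in>D. \<Delta> - s v) = 2 * k + (\<Delta> - 1 + ((k - 1) * (\<Delta> - 2) + 1))" by simp
    moreover obtain k' \<Delta>' where "k = Suc k'" "\<Delta> = \<Delta>' + 2"
      using assms that[of "k - 1" "\<Delta> - 2"] by simp
    ultimately show "k * \<Delta> + 2 = 2 * k + (\<Sum>v\<in>D. \<Delta> - s v)" by (simp add: algebra_simps)
  next
    fix i assume "i \<in> {3..\<Delta> - 1}"
    then have "{v \<in> {..<2 * k} - D. s v = i} = {}" by (auto simp: s_def)
    then show "card {v \<in> {..<2 * k} - D. s v = i} = of_bool (i = 1)"
      using \<open>i \<in> _\<close> by simp
  next
    have "{v \<in> {1..<2 * k} - D. v - 1 \<notin> D \<and> s (v - 1) = 2 \<and> s v = 2} = {2}"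
      using assms by (auto simp: D s_def)
    then show "card {v \<in> {1..<2 * k} - D. v - 1 \<notin> D \<and> s (v - 1) = 2 \<and> s v = 2}
      = (if (1::nat) \<le> 2 then 1 else 0)" by simp
  next
    fix v assume "0 < v" "v \<in> D"
    then show "v - 1 \<notin> D" unfolding D by auto
  next
    fix v assume "v < 2 * k" "v \<notin> D"
    then show "2 \<le> s v \<and> s v < \<Delta>" using assms by (auto simp: D s_def)
  next
    show "s v \<le> \<Delta>" for v using assms by (simp add: s_def)
  qed (use assms D_sub in simp_all)
qed

text \<open>The skeleton is a spider with centre 0 and \<open>j\<close> legs: 2i - 1, 2i for
  \<open>i < j\<close>, and a last leg 2j - 1, 2j, ..., 2k. \<open>D\<close> is the set of positive
  even vertices. The centre keeps degree \<open>j\<close>: for \<open>j = 2\<close> its two edges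
  are those of type \<open>(2, 2)\<close>, for \<open>j \<ge> 3\<close> it is the intermediate
  vertex.\<close>

lemma tree_family_nonempty:
  assumes "\<Delta> \<ge> 3" "2 \<le> j" "j < \<Delta>" "j \<le> k"
  shows "tree_family (k * \<Delta> + 1 + j) \<Delta> \<noteq> ({} :: nat sgraph set)"
proof -
  define D where "D = (\<lambda>i. 2 * i) ` {1..k}"
  define p :: "nat \<Rightarrow> nat" where "p v = (if odd v \<and> v < 2 * j then 0 else v - 1)" for v
  define s :: "nat \<Rightarrow> nat" where
    "s v = (if v = 0 then j else if odd v \<or> 2 * j \<le> v \<and> v < 2 * k then 2 else 1)" for v
  have D: "v \<in> D \<longleftrightarrow> even v \<and> 2 \<le> v \<and> v \<le> 2 * k" for v
    by (auto simp: D_def image_iff elim!: evenE)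
  have D_sub: "D \<subseteq> {..<2 * k + 1}" "D \<noteq> {}" using assms by (auto simp: D_def)
  have odds: "{w. odd w \<and> w < 2 * j} = (\<lambda>i. 2 * i + 1) ` {..<j}"
    by (auto elim!: oddE)
  then have card_odds: "card {w. odd w \<and> w < 2 * j} = j"
    by (simp add: card_image inj_on_def)
  \<comment> \<open>The edges avoiding \<open>D\<close> are exactly those at the centre.\<close>
  have inner: "v \<in> {1..<2 * k + 1} - D \<and> p v \<notin> D \<longleftrightarrow> odd v \<and> v < 2 * j" for v
    using assms by (simp add: D p_def) presburger
  have inner_s: "p v = 0 \<and> s (p v) = j \<and> s v = 2" if "odd v" "v < 2 * j" for v
    using that by (auto simp: p_def s_def)
  \<comment> \<open>With \<open>Q\<close> left open, one computation serves both edge types required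
    by the extension lemma.\<close>
  have inner_set: "{v \<in> {1..<2 * k + 1} - D. p v \<notin> D \<and> Q (s (p v)) (s v)}
      = (if Q j 2 then {w. odd w \<and> w < 2 * j} else {})" for Q
  proof -
    have "v \<in> {1..<2 * k + 1} - D \<and> p v \<notin> D \<and> Q (s (p v)) (s v) \<longleftrightarrow> odd v \<and> v < 2 * j \<and> Q j 2" for v
      using inner[of v] inner_s[of v] by metis
    then show ?thesis by (cases "Q j 2") (simp_all only: simp_thms if_True if_False empty_def)
  qed
  show ?thesis
  proof (rule tree_family_pendent_extension[where m = "2 * k + 1" and p = p and D = D
        and s = s and j = j])
    fix v assume v: "v < 2 * k + 1"
    have "{w \<in> {1..<2 * k + 1}. p w = v} = (if v = 0 then {w. odd w \<and> w < 2 * j}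
        else if v < 2 * k \<and> (odd v \<or> 2 * j \<le> v) then {Suc v} else {})"
    proof (cases "v = 0")
      case True
      have "w \<in> {1..<2 * k + 1} \<and> p w = 0 \<longleftrightarrow> odd w \<and> w < 2 * j" for w
        using assms by (simp add: p_def) presburger
      with True show ?thesis by auto
    next
      case False
      have "even v \<Longrightarrow> Suc v < 2 * j \<longleftrightarrow> v < 2 * j" by presburger
      then have "p w = v \<longleftrightarrow> w = Suc v \<and> (odd v \<or> 2 * j \<le> v)" for w
        using False by (auto simp: p_def)
      with False show ?thesis by auto
    qed
    note children = this
    \<comment> \<open>The last skeleton vertex is even, so every odd \<open>v\<close> has its child
      \<open>Suc v\<close> in range.\<close>
    have "even v \<or> v < 2 * k" using v by presburger
    then show "card {w \<in> {1..<2 * k + 1}. p w = v} + of_bool (v > 0) = s v"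
      unfolding children using assms v card_odds by (auto simp: s_def)
  next
    have "(\<Sum>v\<in>D. \<Delta> - s v) = (\<Sum>i\<in>{1..k}. \<Delta> - s (2 * i))"
      unfolding D_def by (subst sum.reindex) (auto simp: inj_on_def)
    \<comment> \<open>The vertex 2i ends a leg iff \<open>i < j\<close> or \<open>i = k\<close>, and
      then it takes one more pendent vertex; there are \<open>j\<close> legs.\<close>
    also have "\<dots> = (\<Sum>i\<in>{1..k}. (\<Delta> - 2) + (if i < j \<or> i = k then 1 else 0))"
      by (rule sum.cong) (use assms in \<open>auto simp: s_def\<close>)
    also have "\<dots> = k * (\<Delta> - 2) + card ({1..k} \<inter> {i. i < j \<or> i = k})"
      by (subst sum.distrib) (simp add: sum.If_cases)
    also have "{1..k} \<inter> {i. i < j \<or> i = k} = insert k {1..<j}" using assms by auto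
    also have "card (insert k {1..<j}) = j" using assms by simp
    finally have "2 * k + 1 + (\<Sum>v\<in>D. \<Delta> - s v) = 2 * k + 1 + k * (\<Delta> - 2) + j" by simp
    moreover have "k * \<Delta> = 2 * k + k * (\<Delta> - 2)" using assms by (simp add: diff_mult_distrib2)
    ultimately show "k * \<Delta> + 1 + j = 2 * k + 1 + (\<Sum>v\<in>D. \<Delta> - s v)" by simp
  next
    fix i assume i: "i \<in> {3..\<Delta> - 1}"
    then have "{v \<in> {..<2 * k + 1} - D. s v = i} = (if i = j then {0} else {})"
      by (auto simp: s_def D split: if_splits)
    then show "card {v \<in> {..<2 * k + 1} - D. s v = i} = of_bool (i = j)" by simp
  next
    show "card {v \<in> {1..<2 * k + 1} - D. p v \<notin> D \<and> s (p v) = 2 \<and> s v = 2}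
      = (if j \<le> 2 then j else 0)"
      unfolding inner_set[of "\<lambda>a b. a = 2 \<and> b = 2"] using card_odds assms by (cases "j = 2") simp_all
  next
    show "card {v \<in> {1..<2 * k + 1} - D. p v \<notin> D \<and>
        (s (p v) = j \<and> s v = 2 \<or> s (p v) = 2 \<and> s v = j)} = j"
      unfolding inner_set[of "\<lambda>a b. a = j \<and> b = 2 \<or> a = 2 \<and> b = j"] using card_odds by simp
  next
    fix v assume "0 < v" "v \<in> D"
    then show "p v \<notin> D" unfolding D by (auto simp: p_def)
  next
    fix v assume "v < 2 * k + 1" "v \<notin> D"
    then show "2 \<le> s v \<and> s v < \<Delta>" using assms by (auto simp: D s_def)
  next
    show "s v \<le> \<Delta>" for v using assms by (simp add: s_def)
  next
    show "0 < v \<Longrightarrow> p v < v" for v by (simp add: p_def)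
  qed (use assms D_sub in simp_all)
qed

text \<open>Non-emptiness is stated over \<open>nat\<close>, where enough vertices exist for every
  \<open>n\<close>. The values agree even across different vertex types, since
  \<open>sigma_value\<close> depends on \<Delta>, \<open>k\<close> and \<open>j\<close>
  alone.\<close>

theorem proposition4:
  fixes n \<Delta> k j :: nat
  assumes "\<Delta> \<ge> 6"
    and "n = k * \<Delta> + 1 + j"
    and "k \<ge> \<Delta> - 1"
    and "1 \<le> j" and "j \<le> \<Delta> - 1"
  shows "(tree_family n \<Delta> :: nat sgraph set) \<noteq> {}
    \<and> (\<forall>T \<in> (tree_family n \<Delta> :: 'a sgraph set).
         \<forall>T' \<in> (tree_family n \<Delta> :: 'b sgraph set). sigma_irr T = sigma_irr T')"
proof (intro conjI ballI)
  show "(tree_family n \<Delta> :: nat sgraph set) \<noteq> {}"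
  \<comment> \<open>A spider with \<open>j = 1\<close> would have its centre as a leaf hanging on
    vertex 1, an internal leaf of degree 2. For \<open>j \<ge> 2\<close>,
    \<open>j \<le> \<Delta> - 1 \<le> k\<close> leaves room for all legs.\<close>
  proof (cases "j = 1")
    case True
    then have "n = k * \<Delta> + 2" using assms(2) by simp
    then show ?thesis using tree_family_nonempty_1[of \<Delta> k] assms by simp
  next
    case False
    then show ?thesis using tree_family_nonempty[of \<Delta> j k] assms by simp
  qed
next
  fix T :: "'a sgraph" and T' :: "'b sgraph"
  assume "T \<in> tree_family n \<Delta>" "T' \<in> tree_family n \<Delta>"
  moreover have "\<Delta> \<ge> 4" "k \<ge> 1" using assms by simp_all
  ultimately show "sigma_irr T = sigma_irr T'" using assms sigma_irr_tree_family by metis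
qed

end
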